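(* Let $m,p,n$ be positive integers, let $\mathcal{X}\in\mathbb{R}^{m\times p\times n}$ and $r\in\mathbb{N}$. Then $$\inf_{W\in O_n}\|\mathcal{X}-\mathcal{X}_{[r]}(W)\|_F^2=\inf_{M\in\mathbb{R}_\times^n O_n}\|\mathcal{X}-\mathcal{X}_{[r]}(M)\|_F^2 .$$
   Context: $O_n$ is the set of real orthogonal $n\times n$ matrices, $\mathbb{R}_\times$ the set of nonzero real numbers, and $\mathbb{R}_\times^n O_n=\{\operatorname{diag}(d)W: d\in\mathbb{R}_\times^n,\ W\in O_n\}$. $\|\cdot\|_F$ is the Frobenius norm. For invertible $M\in\mathbb{R}^{n\times n}$ and $\mathcal{X}\in\mathbb{R}^{m\times p\times n}$ with frontal slices $\mathcal{X}_{:,:,l}$, the transform domain image $\widehat{\mathcal{X}}=\mathcal{X}\times_3M$ has frontal slices $\widehat{\mathcal{X}}_{:,:,k}=\sum_{l=1}^nM_{k,l}\mathcal{X}_{:,:,l}$. For a matrix $A\in\mathbb{R}^{m\times p}$ and a vector $x\in\mathbb{R}^n$, $A\times_3x\in\mathbb{R}^{m\times p\times n}$ is the tensor with frontal slices $(A\times_3x)_{:,:,k}=x_kA$. $e_k$ is the $k$-th standard basis vector of $\mathbb{R}^n$. Implicit rank-$r$ truncation: let $M\in\mathbb{R}_\times^nO_n$ and $d_k=\|M_{k,:}\|_F$ (Euclidean norm of the $k$-th row). For each $k$ take an SVD $\widehat{\mathcal{X}}_{:,:,k}=\sum_{j=1}^{\min(m,p)}\hat s_{j,j,k}\,\hat u_{j,k}\hat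 v_{j,k}^{\mathsf H}$ (singular values in decreasing order in $j$; this is the transform-domain form of the tensor SVD $\mathcal{X}=\mathcal{U}\star_M\mathcal{S}\star_M\mathcal{V}^{\mathsf H}$). Let $h\mapsto(j_h,k_h)$ be a bijection from $\{1,\dots,n\min(m,p)\}$ onto $\{1,\dots,\min(m,p)\}\times\{1,\dots,n\}$ such that $h<h'$ implies $d_{k_h}^{-2}\hat s_{j_h,j_h,k_h}^2\ge d_{k_{h'}}^{-2}\hat s_{j_{h'},j_{h'},k_{h'}}^2$. Then $$\mathcal{X}_{[r]}(M)=\sum_{h=1}^r\hat s_{j_h,j_h,k_h}\,\hat u_{j_h,k_h}\hat v_{j_h,k_h}^{\mathsf H}\times_3M^{-1}e_{k_h},$$ with $\mathcal{X}_{[r]}(M)=\mathcal{X}$ if $r\ge n\min(m,p)$. Ties may be broken arbitrarily. *)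

theory Defs
  imports "HOL-Analysis.Analysis"
begin

text \<open>
  A tensor of size m x p x n is an element of \<open>real^'p^'m^'n\<close>: the component \<open>X $ k\<close> is the
  \<open>k\<close>-th frontal slice, an m x p matrix. On this type \<open>norm\<close> is the Frobenius norm, since the norm
  of a vector is the \<open>l2\<close> norm of the norms of its components.
\<close>

definition diag_matrix :: "real^'n \<Rightarrow> real^'n^'n" where
  "diag_matrix d = (\<chi> i j. if i = j then d $ i else 0)"

definition scaled_orthogonal :: "(real^'n^'n) set" where
  "scaled_orthogonal =
     {diag_matrix d ** W | d W. (\<forall>i. d $ i \<noteq> 0) \<and> orthogonal_matrix W}"

definition mode3_matrix :: "real^'p^'m^'n \<Rightarrow> real^'n^'n \<Rightarrow> real^'p^'m^'n"  (infixl "\<times>\<^sub>3" 75) where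
  "X \<times>\<^sub>3 M = (\<chi> k. \<Sum>l\<in>UNIV. (M $ k $ l) *\<^sub>R (X $ l))"

definition mode3_vector :: "real^'p^'m \<Rightarrow> real^'n \<Rightarrow> real^'p^'m^'n"  (infixl "\<times>\<^sub>v" 75) where
  "A \<times>\<^sub>v x = (\<chi> k. (x $ k) *\<^sub>R A)"

definition outer_product :: "real^'m \<Rightarrow> real^'p \<Rightarrow> real^'p^'m" where
  "outer_product u v = (\<chi> i j. (u $ i) * (v $ j))"

definition orthonormal_family :: "nat set \<Rightarrow> (nat \<Rightarrow> 'a::real_inner) \<Rightarrow> bool" where
  "orthonormal_family J u \<longleftrightarrow> (\<forall>i\<in>J. \<forall>j\<in>J. u i \<bullet> u j = (if i = j then 1 else 0))"

text \<open>
  The data is real, so singular vectors are taken real and the conjugate transpose is the transpose.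
  Families are indexed by \<open>1..min(m,p)\<close>; values outside this range are irrelevant.
\<close>

definition is_svd ::
  "real^'p^'m \<Rightarrow> (nat \<Rightarrow> real) \<Rightarrow> (nat \<Rightarrow> real^'m) \<Rightarrow> (nat \<Rightarrow> real^'p) \<Rightarrow> bool" where
  "is_svd A s u v \<longleftrightarrow>
     (let q = min CARD('m) CARD('p) in
        orthonormal_family {1..q} u \<and> orthonormal_family {1..q} v \<and>
        (\<forall>j\<in>{1..q}. 0 \<le> s j) \<and>
        (\<forall>i\<in>{1..q}. \<forall>j\<in>{1..q}. i \<le> j \<longrightarrow> s j \<le> s i) \<and>
        A = (\<Sum>j = 1..q. s j *\<^sub>R outer_product (u j) (v j)))"

text \<open>
  Neither the singular value decompositions of the transformed slices nor the ordering of the pairs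
  (index of singular value, index of slice) are unique, so the rank-\<open>r\<close> truncation is a relation:
  \<open>is_truncation r X M Y\<close> says that \<open>Y\<close> is the truncation of \<open>X\<close> under \<open>M\<close> for some admissible
  choice of both. The pair \<open>\<sigma> h\<close> is \<open>(j\<^sub>h, k\<^sub>h)\<close>.
\<close>

definition is_truncation ::
  "nat \<Rightarrow> real^'p^'m^'n \<Rightarrow> real^'n^'n \<Rightarrow> real^'p^'m^'n \<Rightarrow> bool" where
  "is_truncation r X M Y \<longleftrightarrow>
     (let q = min CARD('m) CARD('p); N = CARD('n) * q in
        if N \<le> r then Y = X
        else \<exists>(s :: 'n \<Rightarrow> nat \<Rightarrow> real) (u :: 'n \<Rightarrow> nat \<Rightarrow> real^'m) (v :: 'n \<Rightarrow> nat \<Rightarrow> real^'p)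
                 (\<sigma> :: nat \<Rightarrow> nat \<times> 'n).
          (\<forall>k. is_svd ((X \<times>\<^sub>3 M) $ k) (s k) (u k) (v k)) \<and>
          bij_betw \<sigma> {1..N} ({1..q} \<times> UNIV) \<and>
          (\<forall>h\<in>{1..N}. \<forall>h'\<in>{1..N}. h < h' \<longrightarrow>
             (case \<sigma> h of (j, k) \<Rightarrow> (s k j)\<^sup>2 / (norm (row k M))\<^sup>2) \<ge>
             (case \<sigma> h' of (j, k) \<Rightarrow> (s k j)\<^sup>2 / (norm (row k M))\<^sup>2)) \<and>
          Y = (\<Sum>h = 1..r. case \<sigma> h of (j, k) \<Rightarrow>
                 (s k j *\<^sub>R outer_product (u k j) (v k j)) \<times>\<^sub>v (matrix_inv M *v axis k 1)))"

end

theory Submission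
  imports Defs
begin

text \<open>
  Scaling the rows of an orthogonal transform \<open>W\<close> does not change the truncation error, so both
  infima range over the same set of values.

  Put \<open>M = diag_matrix d ** W\<close>. The \<open>k\<close>-th column of the inverse of \<open>M\<close> is the \<open>k\<close>-th row of
  \<open>W\<close> divided by \<open>d $ k\<close>. Hence the singular value decompositions of the transformed slices write
  \<open>X\<close> as a sum of pairwise orthogonal tensors, one for each pair \<open>(j, k)\<close>: two terms from the same
  slice have orthogonal singular vectors, and two terms from different slices are multiplied by
  orthogonal rows of \<open>W\<close>. The squared norm of a term is its singular value squared divided by
  \<open>(d $ k)\<^sup>2\<close>, which is exactly the key by which the truncation sorts. So the squared error is the sum
  of the keys after the \<open>r\<close>-th in decreasing order (\<open>truncation_error\<close>).

  The \<open>k\<close>-th transformed slice under \<open>M\<close> is \<open>d $ k\<close> times the one under \<open>W\<close>, so its singular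
  values are multiplied by \<open>\<bar>d $ k\<bar>\<close> and the keys are the same for \<open>M\<close> as for \<open>W\<close>. Two kinds of
  arbitrary choice have to be shown harmless. Different decompositions of one matrix have the same
  singular values (\<open>svd_singular_value_unique\<close>, by the Courant--Fischer argument), and different
  ways to break ties list the same sequence of keys (\<open>sorted_enumeration_le\<close>).
\<close>

section \<open>Orthonormal families\<close>

lemma norm_sum_orthonormal_sq:
  assumes "finite J" "orthonormal_family J u"
  shows "(norm (\<Sum>i\<in>J. c i *\<^sub>R u i))\<^sup>2 = (\<Sum>i\<in>J. (c i)\<^sup>2)"
proof -
  have "(norm (\<Sum>i\<in>J. c i *\<^sub>R u i))\<^sup>2 = (\<Sum>i\<in>J. (norm (c i *\<^sub>R u i))\<^sup>2)"
    using assms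
    by (intro norm_sum_Pythagorean)
       (auto simp: pairwise_def orthogonal_def orthonormal_family_def)
  also have "\<dots> = (\<Sum>i\<in>J. (c i)\<^sup>2)"
    using assms(2)
    by (intro sum.cong) (auto simp: power_mult_distrib orthonormal_family_def power2_norm_eq_inner)
  finally show ?thesis .
qed

lemma bessel_inequality:
  assumes "finite J" "orthonormal_family J u"
  shows "(\<Sum>i\<in>J. (u i \<bullet> x)\<^sup>2) \<le> (norm x)\<^sup>2"
proof -
  let ?y = "\<Sum>i\<in>J. (u i \<bullet> x) *\<^sub>R u i"
  have yy: "?y \<bullet> ?y = (\<Sum>i\<in>J. (u i \<bullet> x)\<^sup>2)"
    using norm_sum_orthonormal_sq[OF assms, of "\<lambda>i. u i \<bullet> x"] by (simp add: power2_norm_eq_inner)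
  have xy: "x \<bullet> ?y = (\<Sum>i\<in>J. (u i \<bullet> x)\<^sup>2)"
    by (simp add: inner_sum_right power2_eq_square inner_commute)
  have "0 \<le> (x - ?y) \<bullet> (x - ?y)" by simp
  then show ?thesis
    using xy yy by (simp add: inner_diff_left inner_diff_right inner_commute power2_norm_eq_inner)
qed

lemma orthonormal_expansion:
  assumes "finite J" "orthonormal_family J u" "x \<in> span (u ` J)"
  shows "x = (\<Sum>i\<in>J. (u i \<bullet> x) *\<^sub>R u i)"
proof (rule linear_eq_on[OF linear_ident _ assms(3)])
  show "linear (\<lambda>x. \<Sum>i\<in>J. (u i \<bullet> x) *\<^sub>R u i)"
    by (auto intro!: linearI
        simp: inner_add_right scaleR_add_left sum.distrib scaleR_sum_right)
next
  fix y assume "y \<in> u ` J"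
  then obtain j where j: "j \<in> J" "y = u j" by auto
  have "(\<Sum>i\<in>J. (u i \<bullet> u j) *\<^sub>R u i) = (\<Sum>i\<in>J. if i = j then u i else 0)"
    using assms(2) j by (intro sum.cong) (auto simp: orthonormal_family_def)
  then show "y = (\<Sum>i\<in>J. (u i \<bullet> y) *\<^sub>R u i)" using j assms(1) by simp
qed

lemma dim_span_orthonormal:
  fixes u :: "nat \<Rightarrow> 'a::euclidean_space"
  assumes "finite J" "orthonormal_family J u"
  shows "dim (span (u ` J)) = card J"
proof -
  have inj: "inj_on u J"
  proof (rule inj_onI)
    fix i j assume ij: "i \<in> J" "j \<in> J" "u i = u j"
    then have "u i \<bullet> u j = 1" using assms(2) by (metis orthonormal_family_def)
    moreover have "u i \<bullet> u j = (if i = j then 1 else 0)"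
      using assms(2) ij(1,2) by (simp add: orthonormal_family_def)
    ultimately show "i = j" by (simp split: if_splits)
  qed
  have "0 \<notin> u ` J"
    using assms(2) by (force simp: orthonormal_family_def)
  moreover have "pairwise orthogonal (u ` J)"
    using assms(2) by (auto simp: pairwise_def orthogonal_def orthonormal_family_def)
  ultimately have "independent (u ` J)"
    by (rule pairwise_orthogonal_independent[rotated])
  then show ?thesis
    by (simp add: dim_eq_card_independent card_image[OF inj])
qed

text \<open>
  The orthogonal complement of \<open>F\<close> has codimension at most \<open>card F\<close>, so it meets every subspace of
  larger dimension nontrivially.
\<close>

lemma nonzero_orthogonal_vector_in_subspace:
  fixes S :: "'a::euclidean_space set"
  assumes "subspace S" "finite F" "card F < dim S"
  obtains x where "x \<in> S" "x \<noteq> 0" "\<And>f. f \<in> F \<Longrightarrow> f \<bullet> x = 0"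
proof -
  let ?T = "{y. \<forall>f\<in>span F. orthogonal f y}"
  have "dim {y \<in> UNIV. \<forall>f\<in>span F. orthogonal f y} + dim (span F) = dim (UNIV :: 'a set)"
    by (rule dim_subspace_orthogonal_to_vectors) auto
  then have T: "dim ?T + dim F = DIM('a)" by simp
  have sT: "subspace ?T" by (auto simp: subspace_def orthogonal_def inner_add_right)
  have "dim {x + y |x y. x \<in> S \<and> y \<in> ?T} + dim (S \<inter> ?T) = dim S + dim ?T"
    using dim_sums_Int[OF assms(1) sT] by simp
  moreover have "dim {x + y |x y. x \<in> S \<and> y \<in> ?T} \<le> DIM('a)"
    by (rule dim_subset_UNIV)
  moreover have "dim F \<le> card F"
    using assms(2) by (rule dim_le_card')
  ultimately have "dim (S \<inter> ?T) \<noteq> 0"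
    using T assms(3) by linarith
  then have "\<not> S \<inter> ?T \<subseteq> {0}" by simp
  then obtain x where "x \<in> S" "x \<in> ?T" "x \<noteq> 0" by blast
  then show thesis
    by (intro that[of x]) (auto simp: orthogonal_def span_base)
qed

section \<open>Uniqueness and scaling of singular values\<close>

lemma outer_product_mult_vector: "outer_product u v *v x = (v \<bullet> x) *\<^sub>R u"
  by (simp add: outer_product_def matrix_vector_mult_def vec_eq_iff inner_vec_def
      sum_distrib_left ac_simps)

lemma norm_svd_mult_vector_sq:
  fixes A :: "real^'p^'m"
  assumes "is_svd A s u v"
  shows "(norm (A *v x))\<^sup>2 = (\<Sum>i = 1..min CARD('m) CARD('p). (s i * (v i \<bullet> x))\<^sup>2)"
proof -
  let ?q = "min CARD('m) CARD('p)"
  have lin: "linear (\<lambda>B :: real^'p^'m. B *v x)"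
    by (auto intro!: linearI simp: matrix_vector_mult_add_rdistrib scaleR_matrix_vector_assoc)
  have A: "A = (\<Sum>j = 1..?q. s j *\<^sub>R outer_product (u j) (v j))"
    and u: "orthonormal_family {1..?q} u"
    using assms by (auto simp: is_svd_def Let_def)
  have "A *v x = (\<Sum>j = 1..?q. (s j *\<^sub>R outer_product (u j) (v j)) *v x)"
    by (subst A) (rule linear_sum[OF lin])
  also have "\<dots> = (\<Sum>j = 1..?q. (s j * (v j \<bullet> x)) *\<^sub>R u j)"
    by (simp add: outer_product_mult_vector flip: scaleR_matrix_vector_assoc)
  finally show ?thesis
    using norm_sum_orthonormal_sq[OF _ u] by simp
qed

text \<open>
  This is the Courant--Fischer comparison. On the span of the first \<open>j\<close> right singular vectors of one
  decomposition, \<open>A\<close> stretches by at least \<open>s j\<close>; on the orthogonal complement of the first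
  \<open>j - 1\<close> right singular vectors of the other, it stretches by at most \<open>s' j\<close>. The two subspaces
  share a nonzero vector by dimension count.
\<close>

lemma svd_singular_value_le:
  fixes A :: "real^'p^'m"
  assumes svd: "is_svd A s u v" and svd': "is_svd A s' u' v'"
    and j: "j \<in> {1..min CARD('m) CARD('p)}"
  shows "s j \<le> s' j"
proof (rule ccontr)
  assume "\<not> s j \<le> s' j"
  then have lt: "s' j < s j" by simp
  define q where "q = min CARD('m) CARD('p)"
  have v: "orthonormal_family {1..q} v" and v': "orthonormal_family {1..q} v'"
    and s0: "\<And>i. i \<in> {1..q} \<Longrightarrow> 0 \<le> s i" and s0': "\<And>i. i \<in> {1..q} \<Longrightarrow> 0 \<le> s' i"
    and dec: "\<And>i j. \<lbrakk>i \<in> {1..q}; j \<in> {1..q}; i \<le> j\<rbrakk> \<Longrightarrow> s j \<le> s i"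
    and dec': "\<And>i j. \<lbrakk>i \<in> {1..q}; j \<in> {1..q}; i \<le> j\<rbrakk> \<Longrightarrow> s' j \<le> s' i"
    using svd svd' unfolding is_svd_def Let_def q_def by blast+
  have jq: "j \<in> {1..q}" using j by (simp add: q_def)
  have vj: "orthonormal_family {1..j} v"
    using v jq by (auto simp: orthonormal_family_def)
  \<comment> \<open>The comparison vector lies in a \<open>j\<close>-dimensional space and satisfies \<open>j - 1\<close> linear conditions.\<close>
  have "card (v' ` {1..<j}) \<le> j - 1"
    using card_image_le[of "{1..<j}" v'] by simp
  then have "card (v' ` {1..<j}) < dim (span (v ` {1..j}))"
    using dim_span_orthonormal[OF _ vj] jq by (simp add: less_eq_Suc_le) linarith
  then obtain x where x: "x \<in> span (v ` {1..j})" "x \<noteq> 0"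
      and orth: "\<And>f. f \<in> v' ` {1..<j} \<Longrightarrow> f \<bullet> x = 0"
    by (rule nonzero_orthogonal_vector_in_subspace[OF subspace_span, rotated]) auto
  have normx: "(norm x)\<^sup>2 = (\<Sum>i = 1..j. (v i \<bullet> x)\<^sup>2)"
    using norm_sum_orthonormal_sq[OF _ vj] orthonormal_expansion[OF _ vj x(1)]
    by (metis finite_atLeastAtMost)
  have "(s j)\<^sup>2 * (norm x)\<^sup>2 = (\<Sum>i = 1..j. (s j * (v i \<bullet> x))\<^sup>2)"
    unfolding normx by (simp add: sum_distrib_left power_mult_distrib)
  also have "\<dots> \<le> (\<Sum>i = 1..j. (s i * (v i \<bullet> x))\<^sup>2)"
    using jq s0[OF jq] dec
    by (intro sum_mono) (auto simp: power_mult_distrib intro!: mult_right_mono power_mono)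
  also have "\<dots> \<le> (\<Sum>i = 1..q. (s i * (v i \<bullet> x))\<^sup>2)"
    using jq by (intro sum_mono2) auto
  also have "\<dots> = (norm (A *v x))\<^sup>2"
    using norm_svd_mult_vector_sq[OF svd] by (simp add: q_def)
  also have "\<dots> = (\<Sum>i = 1..q. (s' i * (v' i \<bullet> x))\<^sup>2)"
    using norm_svd_mult_vector_sq[OF svd'] by (simp add: q_def)
  also have "\<dots> \<le> (\<Sum>i = 1..q. (s' j)\<^sup>2 * (v' i \<bullet> x)\<^sup>2)"
  proof (intro sum_mono)
    fix i assume i: "i \<in> {1..q}"
    show "(s' i * (v' i \<bullet> x))\<^sup>2 \<le> (s' j)\<^sup>2 * (v' i \<bullet> x)\<^sup>2"
    proof (cases "i < j")
      case True
      then have "v' i \<bullet> x = 0" using orth i by simp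
      then show ?thesis by simp
    next
      case False
      then show ?thesis
        using i jq dec'[OF jq i] s0'[OF i]
        by (auto simp: power_mult_distrib intro!: mult_right_mono power_mono)
    qed
  qed
  also have "\<dots> \<le> (s' j)\<^sup>2 * (norm x)\<^sup>2"
    using bessel_inequality[OF _ v'] by (simp add: mult_left_mono flip: sum_distrib_left)
  finally have "(s j)\<^sup>2 * (norm x)\<^sup>2 \<le> (s' j)\<^sup>2 * (norm x)\<^sup>2" .
  then have "(s j)\<^sup>2 \<le> (s' j)\<^sup>2" using x(2) by simp
  moreover have "(s' j)\<^sup>2 < (s j)\<^sup>2"
    using lt s0'[OF jq] by (intro power_strict_mono) auto
  ultimately show False by simp
qed

lemma svd_singular_value_unique:
  fixes A :: "real^'p^'m"
  assumes "is_svd A s u v" "is_svd A s' u' v'" "j \<in> {1..min CARD('m) CARD('p)}"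
  shows "s j = s' j"
  using svd_singular_value_le[OF assms] svd_singular_value_le[OF assms(2,1,3)] by simp

lemma outer_product_scaleR_left: "outer_product (c *\<^sub>R u) v = c *\<^sub>R outer_product u v"
  by (simp add: outer_product_def vec_eq_iff)

text \<open>
  Singular values are nonnegative, so the sign of \<open>c\<close> has to go into the left singular vectors.
\<close>

lemma is_svd_scaleR:
  fixes A :: "real^'p^'m"
  assumes "is_svd A s u v" "c \<noteq> 0"
  shows "is_svd (c *\<^sub>R A) (\<lambda>j. \<bar>c\<bar> * s j) (\<lambda>j. sgn c *\<^sub>R u j) v"
proof -
  let ?q = "min CARD('m) CARD('p)"
  have "sgn c * sgn c = 1" using assms(2) by (simp add: sgn_if)
  then have "orthonormal_family {1..?q} (\<lambda>j. sgn c *\<^sub>R u j)"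
    using assms(1) by (simp add: is_svd_def Let_def orthonormal_family_def flip: mult.assoc)
  moreover have "c *\<^sub>R A =
      (\<Sum>j = 1..?q. (\<bar>c\<bar> * s j) *\<^sub>R outer_product (sgn c *\<^sub>R u j) (v j))"
  proof -
    have A: "A = (\<Sum>j = 1..?q. s j *\<^sub>R outer_product (u j) (v j))"
      using assms(1) by (simp add: is_svd_def Let_def)
    have eq: "(\<bar>c\<bar> * s j) * sgn c = c * s j" for j
      by (simp add: mult.commute mult.left_commute abs_mult_sgn)
    then show ?thesis
      by (subst A) (simp add: outer_product_scaleR_left scaleR_sum_right eq)
  qed
  ultimately show ?thesis
    using assms(1) by (simp add: is_svd_def Let_def mult_left_mono)
qed

section \<open>Sorting\<close>

text \<open>
  Two decreasing enumerations agree position by position in their keys, however each breaks ties.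
  Otherwise all of \<open>\<sigma> 1, ..., \<sigma> h\<close> have keys above that of \<open>\<tau> h\<close>, whereas \<open>\<tau>\<close> has room for
  only \<open>h - 1\<close> such elements before position \<open>h\<close>. Exchanging the two enumerations turns the
  inequality into an equality.
\<close>

lemma sorted_enumeration_le:
  fixes a :: "'i \<Rightarrow> 'b::linorder" and \<sigma> \<tau> :: "nat \<Rightarrow> 'i"
  assumes bij: "bij_betw \<sigma> {1..N} S" and bij': "bij_betw \<tau> {1..N} S"
    and dec: "\<And>i j. \<lbrakk>i \<in> {1..N}; j \<in> {1..N}; i < j\<rbrakk> \<Longrightarrow> a (\<sigma> j) \<le> a (\<sigma> i)"
    and dec': "\<And>i j. \<lbrakk>i \<in> {1..N}; j \<in> {1..N}; i < j\<rbrakk> \<Longrightarrow> a (\<tau> j) \<le> a (\<tau> i)"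
    and h: "h \<in> {1..N}"
  shows "a (\<sigma> h) \<le> a (\<tau> h)"
proof (rule ccontr)
  assume neg: "\<not> a (\<sigma> h) \<le> a (\<tau> h)"
  have "\<sigma> ` {1..h} \<subseteq> \<tau> ` {1..<h}"
  proof
    fix y assume "y \<in> \<sigma> ` {1..h}"
    then obtain i where i: "i \<in> {1..h}" "y = \<sigma> i" by auto
    have "a (\<sigma> h) \<le> a y"
      using dec[of i h] i h by (cases "i = h") auto
    then have gt: "a (\<tau> h) < a y" using neg by simp
    have "y \<in> S" using bij i h by (auto simp: bij_betw_def)
    then obtain k where k: "k \<in> {1..N}" "y = \<tau> k" using bij' by (auto simp: bij_betw_def)
    have "k < h"
    proof (rule ccontr)
      assume "\<not> k < h"
      then have "a (\<tau> k) \<le> a (\<tau> h)" using dec'[of h k] h k by (cases "k = h") simp_all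
      then show False using gt k by simp
    qed
    then show "y \<in> \<tau> ` {1..<h}" using k by auto
  qed
  then have "card (\<sigma> ` {1..h}) \<le> card (\<tau> ` {1..<h})" by (intro card_mono) auto
  also have "\<dots> \<le> h - 1" using card_image_le[of "{1..<h}" \<tau>] by simp
  finally have "card (\<sigma> ` {1..h}) \<le> h - 1" .
  moreover have "inj_on \<sigma> {1..h}"
    using h by (intro inj_on_subset[OF bij_betw_imp_inj_on[OF bij]]) auto
  then have "card (\<sigma> ` {1..h}) = h" by (simp add: card_image)
  ultimately show False using h unfolding atLeastAtMost_iff by linarith
qed

section \<open>The truncation error\<close>

lemma inner_mode3_vector: "(A \<times>\<^sub>v x) \<bullet> (B \<times>\<^sub>v y) = (A \<bullet> B) * (x \<bullet> y)"
proof -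
  have "(A \<times>\<^sub>v x) \<bullet> (B \<times>\<^sub>v y) = (\<Sum>k\<in>UNIV. (x $ k *\<^sub>R A) \<bullet> (y $ k *\<^sub>R B))"
    unfolding mode3_vector_def by (subst inner_vec_def) simp
  also have "\<dots> = (A \<bullet> B) * (\<Sum>k\<in>UNIV. x $ k * y $ k)"
    by (simp add: sum_distrib_left ac_simps)
  finally show ?thesis by (simp add: inner_vec_def)
qed

lemma inner_outer_product: "outer_product u v \<bullet> outer_product u' v' = (u \<bullet> u') * (v \<bullet> v')"
  by (simp add: outer_product_def inner_vec_def sum_product ac_simps) (rule sum.swap)

lemma linear_mode3_vector: "linear (\<lambda>A. A \<times>\<^sub>v x)"
  by (auto intro!: linearI simp: mode3_vector_def vec_eq_iff scaleR_add_right algebra_simps)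

lemma matrix_inv_mult_left:
  fixes M :: "real^'n^'n"
  assumes "invertible M"
  shows "matrix_inv M ** M = mat 1"
  using someI_ex[of "\<lambda>B. M ** B = mat 1 \<and> B ** M = mat 1"] assms
  by (simp add: invertible_def matrix_inv_def)

text \<open>
  Transforming along the third mode by \<open>M\<close> and then by its inverse gives back \<open>X\<close>; the second
  transform is written here as a sum over the columns of the inverse.
\<close>

lemma sum_slices_mode3_vector:
  fixes X :: "real^'p^'m^'n"
  assumes "invertible M"
  shows "(\<Sum>k\<in>UNIV. (X \<times>\<^sub>3 M) $ k \<times>\<^sub>v (matrix_inv M *v axis k 1)) = X"
proof -
  have inv: "matrix_inv M ** M = mat 1" using assms by (rule matrix_inv_mult_left)
  have col: "(matrix_inv M *v axis k 1) $ l = matrix_inv M $ l $ k" for k l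
    by (simp add: matrix_vector_mul_component inner_axis)
  have "(\<Sum>k\<in>UNIV. (X \<times>\<^sub>3 M) $ k \<times>\<^sub>v (matrix_inv M *v axis k 1)) $ l = X $ l" for l
  proof -
    have "(\<Sum>k\<in>UNIV. (X \<times>\<^sub>3 M) $ k \<times>\<^sub>v (matrix_inv M *v axis k 1)) $ l
        = (\<Sum>k\<in>UNIV. \<Sum>i\<in>UNIV. (matrix_inv M $ l $ k * M $ k $ i) *\<^sub>R X $ i)"
      by (simp add: mode3_vector_def mode3_matrix_def col scaleR_sum_right)
    also have "\<dots> = (\<Sum>i\<in>UNIV. (matrix_inv M ** M) $ l $ i *\<^sub>R X $ i)"
      by (subst sum.swap) (simp add: matrix_matrix_mult_def scaleR_sum_left)
    also have "\<dots> = X $ l"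
      by (simp add: inv mat_def if_distrib[of "\<lambda>c. c *\<^sub>R _"] sum.delta cong: if_cong)
    finally show ?thesis .
  qed
  then show ?thesis by (simp add: vec_eq_iff)
qed

lemma row_diag_matrix_mult: "row k (diag_matrix d ** W) = d $ k *\<^sub>R row k W"
  by (simp add: row_def diag_matrix_def matrix_matrix_mult_def vec_eq_iff
      if_distrib[of "\<lambda>c. c * _"] sum.delta cong: if_cong)

lemma mode3_diag_matrix_mult:
  "(X \<times>\<^sub>3 (diag_matrix d ** W)) $ k = d $ k *\<^sub>R (X \<times>\<^sub>3 W) $ k"
proof -
  have "(diag_matrix d ** W) $ k $ l = d $ k * W $ k $ l" for l
    using row_diag_matrix_mult[of k d W] by (simp add: row_def vec_eq_iff)
  then show ?thesis by (simp add: mode3_matrix_def scaleR_sum_right)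
qed

lemma norm_row_orthogonal_matrix:
  "orthogonal_matrix (W :: real^'n^'n) \<Longrightarrow> norm (row k W) = 1"
  by (simp add: orthogonal_matrix_orthonormal_rows)

lemma
  assumes d: "\<forall>i. d $ i \<noteq> 0" and W: "orthogonal_matrix W"
  shows invertible_scaled_orthogonal: "invertible (diag_matrix d ** W)"
    and matrix_inv_scaled_orthogonal_axis:
      "matrix_inv (diag_matrix d ** W) *v axis k 1 = inverse (d $ k) *\<^sub>R row k W"
proof -
  let ?M = "diag_matrix d ** W"
  let ?E = "diag_matrix (\<chi> i. inverse (d $ i))"
  have DE: "diag_matrix d ** ?E = mat 1"
    using d by (simp add: diag_matrix_def matrix_matrix_mult_def mat_def vec_eq_iff
      if_distrib[of "\<lambda>c. c * _"] sum.delta cong: if_cong)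
  have WW: "W ** transpose W = mat 1" using W by (simp add: orthogonal_matrix_def)
  have "?M ** (transpose W ** ?E) = diag_matrix d ** (W ** transpose W) ** ?E"
    by (simp add: matrix_mul_assoc)
  then have r: "?M ** (transpose W ** ?E) = mat 1" by (simp add: WW DE)
  then show inv: "invertible ?M" by (auto simp: invertible_right_inverse)
  have "matrix_inv ?M = (matrix_inv ?M ** ?M) ** (transpose W ** ?E)"
    unfolding matrix_mul_assoc[symmetric, of _ ?M] r by simp
  also have "\<dots> = transpose W ** ?E"
    by (simp only: matrix_inv_mult_left[OF inv] matrix_mul_lid)
  finally have "matrix_inv ?M *v axis k 1 = (transpose W ** ?E) *v axis k 1" by simp
  also have "\<dots> = inverse (d $ k) *\<^sub>R row k W"
    by (simp add: vec_eq_iff matrix_vector_mul_component inner_axis matrix_matrix_mult_def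
      diag_matrix_def transpose_def row_def if_distrib[of "\<lambda>c. _ * c"] sum.delta cong: if_cong)
  finally show "matrix_inv ?M *v axis k 1 = inverse (d $ k) *\<^sub>R row k W" .
qed

text \<open>
  The full sum over all pairs \<open>(j, k)\<close> is \<open>X\<close>, and its terms are pairwise orthogonal, so the error
  of keeping \<open>r\<close> of them is given by Pythagoras on the others.
\<close>

lemma truncation_error:
  fixes X :: "real^'p^'m^'n"
  defines "q \<equiv> min CARD('m) CARD('p)"
  defines "N \<equiv> CARD('n) * q"
  assumes d: "\<forall>i. d $ i \<noteq> 0" and W: "orthogonal_matrix W"
    and svd: "\<And>k. is_svd ((X \<times>\<^sub>3 (diag_matrix d ** W)) $ k) (s k) (u k) (v k)"
    and bij: "bij_betw \<sigma> {1..N} ({1..q} \<times> (UNIV :: 'n set))"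
    and r: "r \<le> N"
    and Y: "Y = (\<Sum>h = 1..r. case \<sigma> h of (j, k) \<Rightarrow>
              (s k j *\<^sub>R outer_product (u k j) (v k j)) \<times>\<^sub>v
              (matrix_inv (diag_matrix d ** W) *v axis k 1))"
  shows "(norm (X - Y))\<^sup>2 = (\<Sum>h = r+1..N. case \<sigma> h of (j, k) \<Rightarrow> (s k j)\<^sup>2 / (d $ k)\<^sup>2)"
proof -
  let ?M = "diag_matrix d ** W"
  define t where "t = (\<lambda>(j, k). (s k j *\<^sub>R outer_product (u k j) (v k j)) \<times>\<^sub>v (matrix_inv ?M *v axis k 1))"
  let ?S = "{1..q} \<times> (UNIV :: 'n set)"
  have u: "\<And>k. orthonormal_family {1..q} (u k)" and v: "\<And>k. orthonormal_family {1..q} (v k)"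
    and A: "\<And>k. (X \<times>\<^sub>3 ?M) $ k = (\<Sum>j = 1..q. s k j *\<^sub>R outer_product (u k j) (v k j))"
    using svd unfolding is_svd_def Let_def q_def by blast+
  have t: "t (j, k) \<bullet> t (j', k') =
      s k j * s k' j' * (u k j \<bullet> u k' j') * (v k j \<bullet> v k' j') *
      inverse (d $ k) * inverse (d $ k') * (row k W \<bullet> row k' W)" for j k j' k'
    unfolding t_def prod.case inner_mode3_vector matrix_inv_scaled_orthogonal_axis[OF d W]
    by (simp add: inner_outer_product)
  have orth: "t x \<bullet> t y = 0" if "x \<in> ?S" "y \<in> ?S" "x \<noteq> y" for x y
  proof -
    obtain j k j' k' where eq: "x = (j, k)" "y = (j', k')" by (cases x, cases y)
    show ?thesis
    proof (cases "k = k'")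
      case True
      then have "u k j \<bullet> u k' j' = 0" using that u[of k] by (auto simp: eq orthonormal_family_def)
      then show ?thesis by (simp add: eq t)
    next
      case False
      then have "row k W \<bullet> row k' W = 0"
        using W by (simp add: orthogonal_matrix_orthonormal_rows orthogonal_def)
      then show ?thesis by (simp add: eq t)
    qed
  qed
  have norm_t: "(norm (t x))\<^sup>2 = (case x of (j, k) \<Rightarrow> (s k j)\<^sup>2 / (d $ k)\<^sup>2)" if "x \<in> ?S" for x
  proof -
    obtain j k where eq: "x = (j, k)" by (cases x)
    have "row k W \<bullet> row k W = 1"
      using norm_row_orthogonal_matrix[OF W, of k] by (simp add: norm_eq_1)
    moreover have "u k j \<bullet> u k j = 1" "v k j \<bullet> v k j = 1"
      using u[of k] v[of k] that by (auto simp: eq orthonormal_family_def)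
    ultimately show ?thesis
      by (simp add: eq t power2_norm_eq_inner) (simp add: power2_eq_square divide_inverse)
  qed
  have "X = (\<Sum>k\<in>UNIV. (X \<times>\<^sub>3 ?M) $ k \<times>\<^sub>v (matrix_inv ?M *v axis k 1))"
    by (simp add: sum_slices_mode3_vector[OF invertible_scaled_orthogonal[OF d W]])
  also have "\<dots> = (\<Sum>k\<in>UNIV. \<Sum>j = 1..q. t (j, k))"
    unfolding A t_def by (simp add: linear_sum[OF linear_mode3_vector])
  also have "\<dots> = (\<Sum>x\<in>?S. t x)"
    by (subst sum.swap) (simp add: sum.cartesian_product)
  also have "\<dots> = (\<Sum>h = 1..N. t (\<sigma> h))"
    by (rule sum.reindex_bij_betw[OF bij, symmetric])
  also have "{1..N} = {1..r} \<union> {r+1..N}" using r by auto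
  also have "(\<Sum>h\<in>{1..r} \<union> {r+1..N}. t (\<sigma> h)) = (\<Sum>h = 1..r. t (\<sigma> h)) + (\<Sum>h = r+1..N. t (\<sigma> h))"
    by (rule sum.union_disjoint) auto
  also have "(\<Sum>h = 1..r. t (\<sigma> h)) = Y" by (simp add: Y t_def)
  finally have "X - Y = (\<Sum>h = r+1..N. t (\<sigma> h))" by (simp add: algebra_simps)
  then have "(norm (X - Y))\<^sup>2 = (norm (\<Sum>h = r+1..N. t (\<sigma> h)))\<^sup>2" by simp
  also have "\<dots> = (\<Sum>h = r+1..N. (norm (t (\<sigma> h)))\<^sup>2)"
  proof (rule norm_sum_Pythagorean)
    have "\<sigma> h \<in> ?S" if "h \<in> {r+1..N}" for h using that bij bij_betwE by fastforce
    moreover have "\<sigma> h \<noteq> \<sigma> h'" if "h \<in> {r+1..N}" "h' \<in> {r+1..N}" "h \<noteq> h'" for h h'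
      using that bij inj_onD[of \<sigma> "{1..N}" h h'] by (auto simp: bij_betw_def)
    ultimately show "pairwise (\<lambda>i j. orthogonal (t (\<sigma> i)) (t (\<sigma> j))) {r+1..N}"
      using orth by (auto simp: pairwise_def orthogonal_def)
  qed simp
  also have "\<dots> = (\<Sum>h = r+1..N. case \<sigma> h of (j, k) \<Rightarrow> (s k j)\<^sup>2 / (d $ k)\<^sup>2)"
  proof (rule sum.cong[OF refl])
    fix h assume "h \<in> {r+1..N}"
    then have "\<sigma> h \<in> ?S" using bij bij_betwE by fastforce
    then show "(norm (t (\<sigma> h)))\<^sup>2 = (case \<sigma> h of (j, k) \<Rightarrow> (s k j)\<^sup>2 / (d $ k)\<^sup>2)"
      by (rule norm_t)
  qed
  finally show ?thesis .
qed

lemma diag_matrix_one_mult: "diag_matrix 1 ** (W :: real^'n^'n) = W"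
proof -
  have "diag_matrix 1 = (mat 1 :: real^'n^'n)" by (simp add: diag_matrix_def mat_def vec_eq_iff)
  then show ?thesis by simp
qed

text \<open>
  Scaling row \<open>k\<close> by \<open>d $ k\<close> multiplies both the singular values of slice \<open>k\<close> and the norm of the
  row by \<open>\<bar>d $ k\<bar>\<close>, so the sorting keys, whose tail sum is the error, do not change.
\<close>

lemma truncation_error_scaling_invariant:
  fixes X :: "real^'p^'m^'n"
  assumes d: "\<forall>i. d $ i \<noteq> 0" and W: "orthogonal_matrix W"
    and Y: "is_truncation r X (diag_matrix d ** W) Y" and Z: "is_truncation r X W Z"
  shows "(norm (X - Y))\<^sup>2 = (norm (X - Z))\<^sup>2"
proof (cases "CARD('n) * min CARD('m) CARD('p) \<le> r")
  case True
  then show ?thesis using Y Z by (simp add: is_truncation_def Let_def)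
next
  case False
  define q where "q = min CARD('m) CARD('p)"
  define N where "N = CARD('n) * q"
  let ?M = "diag_matrix d ** W"
  have rN: "\<not> N \<le> r" using False by (simp add: N_def q_def)
  obtain s u v \<sigma> where
      svd: "\<And>k. is_svd ((X \<times>\<^sub>3 ?M) $ k) (s k) (u k) (v k)"
    and bij: "bij_betw \<sigma> {1..N} ({1..q} \<times> (UNIV :: 'n set))"
    and dec: "\<And>h h'. \<lbrakk>h \<in> {1..N}; h' \<in> {1..N}; h < h'\<rbrakk> \<Longrightarrow>
             (case \<sigma> h' of (j, k) \<Rightarrow> (s k j)\<^sup>2 / (norm (row k ?M))\<^sup>2) \<le>
             (case \<sigma> h of (j, k) \<Rightarrow> (s k j)\<^sup>2 / (norm (row k ?M))\<^sup>2)"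
    and Y: "Y = (\<Sum>h = 1..r. case \<sigma> h of (j, k) \<Rightarrow>
                 (s k j *\<^sub>R outer_product (u k j) (v k j)) \<times>\<^sub>v (matrix_inv ?M *v axis k 1))"
    using Y rN unfolding is_truncation_def Let_def N_def q_def by (simp only: if_False) blast
  obtain s' u' v' \<tau> where
      svd': "\<And>k. is_svd ((X \<times>\<^sub>3 W) $ k) (s' k) (u' k) (v' k)"
    and bij': "bij_betw \<tau> {1..N} ({1..q} \<times> (UNIV :: 'n set))"
    and dec': "\<And>h h'. \<lbrakk>h \<in> {1..N}; h' \<in> {1..N}; h < h'\<rbrakk> \<Longrightarrow>
             (case \<tau> h' of (j, k) \<Rightarrow> (s' k j)\<^sup>2 / (norm (row k W))\<^sup>2) \<le>
             (case \<tau> h of (j, k) \<Rightarrow> (s' k j)\<^sup>2 / (norm (row k W))\<^sup>2)"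
    and Z: "Z = (\<Sum>h = 1..r. case \<tau> h of (j, k) \<Rightarrow>
                 (s' k j *\<^sub>R outer_product (u' k j) (v' k j)) \<times>\<^sub>v (matrix_inv W *v axis k 1))"
    using Z rN unfolding is_truncation_def Let_def N_def q_def by (simp only: if_False) blast
  \<comment> \<open>The sorting keys under \<open>diag_matrix d ** W\<close> and under \<open>W\<close>, whose rows are unit vectors.\<close>
  define a where "a = (\<lambda>(j, k). (s k j)\<^sup>2 / (d $ k)\<^sup>2)"
  define b where "b = (\<lambda>(j, k). (s' k j)\<^sup>2)"
  have ab: "a x = b x" if "x \<in> {1..q} \<times> UNIV" for x
  proof -
    obtain j k where x: "x = (j, k)" by (cases x)
    have "s k j = \<bar>d $ k\<bar> * s' k j"
      using that d svd_singular_value_unique[OF svd[of k, unfolded mode3_diag_matrix_mult]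
          is_svd_scaleR[OF svd'[of k], of "d $ k"], of j]
      by (simp add: x q_def)
    then show ?thesis using d by (simp add: x a_def b_def power_mult_distrib)
  qed
  have S: "\<sigma> h \<in> {1..q} \<times> UNIV" "\<tau> h \<in> {1..q} \<times> UNIV" if "h \<in> {1..N}" for h
    using that bij bij' bij_betwE by blast+
  have "a = (\<lambda>(j, k). (s k j)\<^sup>2 / (norm (row k ?M))\<^sup>2)"
    by (simp add: a_def row_diag_matrix_mult norm_row_orthogonal_matrix[OF W])
  then have deca: "a (\<sigma> h') \<le> a (\<sigma> h)" if "h \<in> {1..N}" "h' \<in> {1..N}" "h < h'" for h h'
    using dec[OF that] by simp
  have "b = (\<lambda>(j, k). (s' k j)\<^sup>2 / (norm (row k W))\<^sup>2)"
    by (simp add: b_def norm_row_orthogonal_matrix[OF W])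
  then have decb: "a (\<tau> h') \<le> a (\<tau> h)" if "h \<in> {1..N}" "h' \<in> {1..N}" "h < h'" for h h'
    using dec'[OF that] ab S that by simp
  have "(norm (X - Y))\<^sup>2 = (\<Sum>h = r+1..N. a (\<sigma> h))"
    unfolding a_def N_def q_def
    using d W svd bij rN by (intro truncation_error) (auto simp: N_def q_def Y)
  also have "\<dots> = (\<Sum>h = r+1..N. b (\<tau> h))"
  proof (rule sum.cong[OF refl])
    fix h assume "h \<in> {r+1..N}"
    then have h: "h \<in> {1..N}" by simp
    have "a (\<sigma> h) = a (\<tau> h)"
      using sorted_enumeration_le[OF bij bij' deca decb h]
        sorted_enumeration_le[OF bij' bij decb deca h] by (rule antisym)
    then show "a (\<sigma> h) = b (\<tau> h)" using ab S h by simp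
  qed
  \<comment> \<open>The plain orthogonal transform is the case of the all-ones scaling.\<close>
  also have "\<dots> = (\<Sum>h = r+1..N. case \<tau> h of (j, k) \<Rightarrow> (s' k j)\<^sup>2 / ((1::real^'n) $ k)\<^sup>2)"
    by (simp add: b_def)
  also have "\<dots> = (norm (X - Z))\<^sup>2"
    unfolding N_def q_def
    using W svd' bij' rN
    by (intro truncation_error[symmetric]) (auto simp: N_def q_def Z diag_matrix_one_mult)
  finally show ?thesis .
qed

theorem theorem4p5:
  fixes X :: "real^'p^'m^'n"
    and r :: nat
    and trunc :: "real^'n^'n \<Rightarrow> real^'p^'m^'n"
  assumes "\<And>M. M \<in> scaled_orthogonal \<Longrightarrow> is_truncation r X M (trunc M)"
  shows "(INF W\<in>{W. orthogonal_matrix W}. (norm (X - trunc W))\<^sup>2) =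
         (INF M\<in>scaled_orthogonal. (norm (X - trunc M))\<^sup>2)"
proof -
  let ?f = "\<lambda>M. (norm (X - trunc M))\<^sup>2"
  have sub: "W \<in> scaled_orthogonal" if "orthogonal_matrix W" for W :: "real^'n^'n"
    unfolding scaled_orthogonal_def
    using that by (auto intro!: exI[of _ "1::real^'n"] exI[of _ W] simp: diag_matrix_one_mult)
  have "?f ` {W. orthogonal_matrix W} = ?f ` scaled_orthogonal"
  proof
    show "?f ` {W. orthogonal_matrix W} \<subseteq> ?f ` scaled_orthogonal" using sub by blast
    show "?f ` scaled_orthogonal \<subseteq> ?f ` {W. orthogonal_matrix W}"
    proof
      fix y assume "y \<in> ?f ` scaled_orthogonal"
      then obtain d W where d: "\<forall>i. d $ i \<noteq> 0" and W: "orthogonal_matrix W"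
        and M: "diag_matrix d ** W \<in> scaled_orthogonal" and y: "y = ?f (diag_matrix d ** W)"
        unfolding scaled_orthogonal_def by blast
      have "y = ?f W"
        unfolding y
        by (rule truncation_error_scaling_invariant[OF d W assms[OF M] assms[OF sub[OF W]]])
      then show "y \<in> ?f ` {W. orthogonal_matrix W}" using W by blast
    qed
  qed
  then show ?thesis by simp
qed

end
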